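(* The number of order-different XOS functions on $V=[n]$ (i.e., the number of order-equivalence classes of XOS functions $f\colon 2^{[n]}\to\mathbb{R}$) is $2^{2^{\Theta(n)}}$.
   Context: A set function $g\colon 2^V\to\mathbb{R}$ is additive if $g(X)=\sum_{v\in X}g(\{v\})$ for all $X\subseteq V$. A function $f\colon 2^V\to\mathbb{R}$ is XOS if there are finitely many additive functions $f_1,\dots,f_k\colon 2^V\to\mathbb{R}$ (values may be negative) with $f(X)=\max_{i\in[k]}f_i(X)$ for all $X\subseteq V$. Two set functions $f,g\colon 2^V\to\mathbb{R}$ are order-equivalent if for all $X,Y\subseteq V$, $f(X)\le f(Y)$ if and only if $g(X)\le g(Y)$; otherwise they are order-different. *)

theory Defs
  imports Complex_Main "HOL-Library.FuncSet" "HOL-Library.Landau_Symbols"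
begin

definition additive_set_fun :: "'a set \<Rightarrow> ('a set \<Rightarrow> real) \<Rightarrow> bool" where
  "additive_set_fun V g \<longleftrightarrow> (\<forall>X\<subseteq>V. g X = (\<Sum>v\<in>X. g {v}))"

text \<open>The maximum is over a nonempty index range, hence \<open>k \<ge> 1\<close>.\<close>

definition XOS :: "'a set \<Rightarrow> ('a set \<Rightarrow> real) \<Rightarrow> bool" where
  "XOS V f \<longleftrightarrow>
     (\<exists>(k::nat) F. k \<ge> 1 \<and> (\<forall>i\<in>{1..k}. additive_set_fun V (F i)) \<and>
        (\<forall>X\<subseteq>V. f X = Max ((\<lambda>i. F i X) ` {1..k})))"

definition order_equivalent ::
    "'a set \<Rightarrow> ('a set \<Rightarrow> real) \<Rightarrow> ('a set \<Rightarrow> real) \<Rightarrow> bool" where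
  "order_equivalent V f g \<longleftrightarrow>
     (\<forall>X Y. X \<subseteq> V \<longrightarrow> Y \<subseteq> V \<longrightarrow> (f X \<le> f Y \<longleftrightarrow> g X \<le> g Y))"

text \<open>
  A function from the subsets of \<open>V\<close> to the reals is represented by its extensional
  extension, so that it is determined by its values on the subsets of \<open>V\<close>.
\<close>

definition XOS_functions :: "'a set \<Rightarrow> ('a set \<Rightarrow> real) set" where
  "XOS_functions V = {f \<in> Pow V \<rightarrow>\<^sub>E UNIV. XOS V f}"

definition XOS_order_rel :: "'a set \<Rightarrow> (('a set \<Rightarrow> real) \<times> ('a set \<Rightarrow> real)) set" where
  "XOS_order_rel V =
     {(f, g). f \<in> XOS_functions V \<and> g \<in> XOS_functions V \<and> order_equivalent V f g}"

lemma equiv_XOS_order_rel: "equiv (XOS_functions V) (XOS_order_rel V)"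
  by (rule equivI)
    (auto simp: XOS_order_rel_def order_equivalent_def refl_on_def sym_def trans_def)

definition num_XOS_classes :: "nat \<Rightarrow> nat" where
  "num_XOS_classes n = card (XOS_functions {1..n} // XOS_order_rel {1..n})"

end

theory Submission
  imports Defs
begin

text \<open>
  The class of \<open>f\<close> is determined by the relation \<open>f X \<le> f Y\<close> on the subsets of \<open>[n]\<close>, and there
  are \<open>2^(4^n)\<close> relations. Conversely, fix \<open>m \<ge> 1\<close> and let \<open>S\<close> be any family of \<open>m\<close>-subsets of
  \<open>[n]\<close>. Let \<open>f\<close> be the maximum of the additive functions with weight \<open>1\<close> inside and \<open>-n\<close> outside
  \<open>X\<close>, for \<open>X \<in> S\<close>, and the one with all weights \<open>-1\<close>. An \<open>m\<close>-set \<open>Y\<close> then has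
  \<open>f Y > f {}\<close> iff \<open>Y \<in> S\<close>, so there are at least \<open>2^(n choose m)\<close> classes.
\<close>

text \<open>The classes are exactly the nonempty fibres of \<open>\<phi>\<close>, one for each value
  that \<open>\<phi>\<close> takes.\<close>

lemma card_quotient_kernel:
  "card (A // {(x, y). x \<in> A \<and> y \<in> A \<and> \<phi> x = \<phi> y}) = card (\<phi> ` A)"
proof -
  let ?fibre = "\<lambda>p. {x \<in> A. \<phi> x = p}"
  have "{(x, y). x \<in> A \<and> y \<in> A \<and> \<phi> x = \<phi> y} `` {a} = ?fibre (\<phi> a)" if "a \<in> A" for a
    using that by auto
  then have "A // {(x, y). x \<in> A \<and> y \<in> A \<and> \<phi> x = \<phi> y} = ?fibre ` \<phi> ` A"
    by (simp add: quotient_def UNION_singleton_eq_range image_image cong: image_cong)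
  moreover have "inj_on ?fibre (\<phi> ` A)"
    by (rule inj_onI) blast
  ultimately show ?thesis
    by (simp add: card_image)
qed

text \<open>Recording the order as a set of pairs makes order equivalence the kernel of a map, so
  that classes are counted as values of that map.\<close>

definition order_graph :: "'a set \<Rightarrow> ('a set \<Rightarrow> real) \<Rightarrow> ('a set \<times> 'a set) set" where
  "order_graph V f = {(X, Y). X \<subseteq> V \<and> Y \<subseteq> V \<and> f X \<le> f Y}"

lemma order_equivalent_iff_order_graph:
  "order_equivalent V f g \<longleftrightarrow> order_graph V f = order_graph V g"
  by (auto simp: order_equivalent_def order_graph_def set_eq_iff)

lemma num_XOS_classes_eq:
  "num_XOS_classes n = card (order_graph {1..n} ` XOS_functions {1..n})"
  by (simp add: num_XOS_classes_def XOS_order_rel_def order_equivalent_iff_order_graph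
      card_quotient_kernel)

lemma order_graph_image_subset: "order_graph V ` A \<subseteq> Pow (Pow V \<times> Pow V)"
  by (auto simp: order_graph_def)

lemma num_XOS_classes_le: "num_XOS_classes n \<le> 2 ^ (2 ^ (2 * n))"
proof -
  have "num_XOS_classes n \<le> card (Pow (Pow {1..n} \<times> Pow {1..n}))"
    unfolding num_XOS_classes_eq by (intro card_mono order_graph_image_subset) simp
  also have "\<dots> = 2 ^ (2 ^ (2 * n))"
    by (simp add: card_Pow card_cartesian_product mult_2 power_add)
  finally show ?thesis .
qed

text \<open>Additive functions are given here by their weights, and the numbering by
  \<open>{1..k}\<close> is replaced by an arbitrary finite nonempty set of weights.\<close>

lemma XOS_Max:
  assumes W: "finite W" "W \<noteq> {}" and f: "\<And>X. X \<subseteq> V \<Longrightarrow> f X = (MAX w\<in>W. sum w X)"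
  shows "XOS V f"
proof -
  obtain e where "bij_betw e {1..card W} W"
    using ex_bij_betw_nat_finite_1[OF W(1)] by blast
  then have e: "e ` {1..card W} = W"
    by (simp add: bij_betw_def)
  have "1 \<le> card W"
    using W by (simp add: Suc_le_eq card_gt_0_iff)
  moreover have "\<forall>i\<in>{1..card W}. additive_set_fun V (sum (e i))"
    by (simp add: additive_set_fun_def)
  moreover have "\<forall>X\<subseteq>V. f X = Max ((\<lambda>i. sum (e i) X) ` {1..card W})"
  proof (intro allI impI)
    fix X assume "X \<subseteq> V"
    have "(\<lambda>i. sum (e i) X) ` {1..card W} = (\<lambda>w. sum w X) ` e ` {1..card W}"
      by (simp only: image_image)
    then show "f X = Max ((\<lambda>i. sum (e i) X) ` {1..card W})"
      using f[OF \<open>X \<subseteq> V\<close>] by (simp only: e)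
  qed
  ultimately show ?thesis
    unfolding XOS_def by (intro exI[of _ "card W"] exI[of _ "\<lambda>i. sum (e i)"] conjI)
qed

text \<open>The constant weight keeps the set nonempty when \<open>S = {}\<close> and never
  contributes a positive sum.\<close>

definition selector_weights :: "nat \<Rightarrow> 'a set set \<Rightarrow> ('a \<Rightarrow> real) set" where
  "selector_weights n S =
     insert (\<lambda>v. - 1) ((\<lambda>X v. if v \<in> X then 1 else - real n) ` S)"

definition selector_XOS :: "'a set \<Rightarrow> 'a set set \<Rightarrow> 'a set \<Rightarrow> real" where
  "selector_XOS V S =
     restrict (\<lambda>Y. MAX w\<in>selector_weights (card V) S. sum w Y) (Pow V)"

lemma selector_XOS_in_XOS_functions:
  assumes "finite S"
  shows "selector_XOS V S \<in> XOS_functions V"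
proof -
  have "XOS V (selector_XOS V S)"
    by (rule XOS_Max[where W = "selector_weights (card V) S"])
      (use assms in \<open>auto simp: selector_weights_def selector_XOS_def\<close>)
  then show ?thesis
    by (simp add: XOS_functions_def selector_XOS_def)
qed

lemma selector_XOS_empty: "finite S \<Longrightarrow> selector_XOS V S {} = 0"
  by (simp add: selector_XOS_def selector_weights_def image_image image_constant_conv)

text \<open>A maximum is positive iff one of its members is. The member of \<open>X \<in> S\<close>
  has value \<open>m > 0\<close> at \<open>Y = X\<close>; otherwise \<open>Y\<close> has an element
  outside \<open>X\<close>, whose penalty \<open>card V\<close> cancels all gains.\<close>

lemma selector_XOS_pos_iff:
  assumes V: "finite V" and m: "1 \<le> m" and S: "S \<subseteq> {X. X \<subseteq> V \<and> card X = m}"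
    and Y: "Y \<subseteq> V" "card Y = m"
  shows "0 < selector_XOS V S Y \<longleftrightarrow> Y \<in> S"
proof -
  have finS: "finite S"
    using S V by (auto intro: finite_subset[of S "Pow V"])
  have finY: "finite Y"
    using Y V finite_subset by blast
  have mV: "m \<le> card V"
    using Y V card_mono by blast
  have pos: "0 < (\<Sum>v\<in>Y. if v \<in> X then 1 else - real (card V)) \<longleftrightarrow> X = Y" if "X \<in> S" for X
  proof (cases "X = Y")
    case True
    then show ?thesis using m Y by simp
  next
    case False
    have X: "finite X" "card X = m"
      using that S V by (auto intro: finite_subset[of X V])
    \<comment> \<open>Here the equal cardinalities matter: an inclusion would force
      \<open>Y = X\<close>.\<close>
    then have "\<not> Y \<subseteq> X"
      using False Y card_subset_eq by blast
    then have "Y - X \<noteq> {}" by blast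
    then have "1 \<le> card (Y - X)"
      using finY by (simp add: Suc_le_eq card_gt_0_iff)
    then have "real (card V) \<le> real (card (Y - X)) * real (card V)"
      by (simp add: mult_le_cancel_right1)
    moreover have "card (Y \<inter> X) \<le> card V"
      using finY Y mV by (metis card_mono inf_le1 le_trans)
    moreover have "(\<Sum>v\<in>Y. if v \<in> X then 1 else - real (card V))
        = real (card (Y \<inter> X)) - real (card (Y - X)) * real (card V)"
      using finY by (simp add: sum.If_cases Diff_eq)
    ultimately show ?thesis
      using False by simp
  qed
  have "0 < selector_XOS V S Y \<longleftrightarrow> (\<exists>w\<in>selector_weights (card V) S. 0 < sum w Y)"
    using Y finS by (simp add: selector_XOS_def selector_weights_def Max_gr_iff)
  also have "\<dots> \<longleftrightarrow> Y \<in> S"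
    using pos by (auto simp: selector_weights_def)
  finally show ?thesis .
qed

text \<open>The family \<open>S\<close> can be read off the order graph: it consists of the
  \<open>m\<close>-sets that lie strictly above \<open>{}\<close>. Distinct families thus give
  distinct classes.\<close>

lemma num_XOS_classes_ge:
  assumes m: "1 \<le> m"
  shows "2 ^ (n choose m) \<le> num_XOS_classes n"
proof -
  let ?V = "{1..n}"
  let ?L = "{X. X \<subseteq> ?V \<and> card X = m}"
  let ?\<phi> = "\<lambda>S. order_graph ?V (selector_XOS ?V S)"
  have fin: "finite S" if "S \<subseteq> ?L" for S
    by (rule finite_subset[of S "Pow ?V"]) (use that in auto)
  have mem: "Y \<in> S \<longleftrightarrow> Y \<in> ?L \<and> (Y, {}) \<notin> ?\<phi> S" if S: "S \<subseteq> ?L" for S Y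
    using selector_XOS_pos_iff[OF _ m S, of Y] selector_XOS_empty[OF fin[OF S], of ?V] S
    by (auto simp: order_graph_def not_le)
  have "inj_on ?\<phi> (Pow ?L)"
  proof (rule inj_onI)
    fix S T assume "S \<in> Pow ?L" "T \<in> Pow ?L" "?\<phi> S = ?\<phi> T"
    then show "S = T"
      using mem[of S] mem[of T] by (simp add: set_eq_iff)
  qed
  then have "card (Pow ?L) = card (?\<phi> ` Pow ?L)"
    by (simp add: card_image)
  also have "\<dots> \<le> num_XOS_classes n"
    unfolding num_XOS_classes_eq
  proof (rule card_mono)
    show "finite (order_graph ?V ` XOS_functions ?V)"
      by (rule finite_subset[OF order_graph_image_subset]) simp
    show "?\<phi> ` Pow ?L \<subseteq> order_graph ?V ` XOS_functions ?V"
      using selector_XOS_in_XOS_functions[OF fin] by blast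
  qed
  finally show ?thesis
    using fin[of ?L] by (simp add: card_Pow n_subsets)
qed

text \<open>For \<open>0 < k \<le> n\<close>, \<open>n choose k\<close> is at least
  \<open>(n / k) ^ k\<close>, and \<open>n / k \<ge> 2\<close> for
  \<open>k = n div 2\<close>.\<close>

lemma two_pow_le_binomial_half: "(2::nat) ^ (n div 2) \<le> n choose (n div 2)"
proof (cases "n div 2 = 0")
  case False
  then have "2 \<le> real n / real (n div 2)"
    by (simp add: field_simps flip: of_nat_mult)
  then have "2 ^ (n div 2) \<le> (real n / real (n div 2)) ^ (n div 2)"
    by (intro power_mono) auto
  also have "\<dots> \<le> real (n choose (n div 2))"
    using binomial_ge_n_over_k_pow_k[of "n div 2" n, where ?'a = real] by simp
  finally show ?thesis
    by (metis of_nat_le_iff of_nat_numeral of_nat_power)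
qed simp

theorem corollary21:
  "\<exists>h :: nat \<Rightarrow> real. h \<in> \<Theta>(\<lambda>n. real n) \<and>
     (\<forall>n\<ge>1. real (num_XOS_classes n) = 2 powr (2 powr h n))"
proof -
  \<comment> \<open>The required equation forces this choice for \<open>n \<ge> 1\<close>; the
    bounds on the count then become linear bounds on \<open>h\<close>.\<close>
  define h where "h n = log 2 (log 2 (real (num_XOS_classes n)))" for n
  \<comment> \<open>With at least two classes the inner logarithm is positive, so both logarithms
    can be inverted. The singletons, \<open>m = 1\<close>, suffice for this.\<close>
  have gt1: "1 < real (num_XOS_classes n)" if "1 \<le> n" for n
  proof -
    have "(2::nat) ^ 1 \<le> 2 ^ (n choose 1)"
      using that by (intro power_increasing) auto
    then show ?thesis
      using num_XOS_classes_ge[of 1 n] by simp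
  qed
  have exact: "real (num_XOS_classes n) = 2 powr (2 powr h n)" if "1 \<le> n" for n
    using gt1[OF that] by (simp add: h_def)
  have upper: "h n \<le> 2 * real n" if "1 \<le> n" for n
  proof -
    have "2 powr (2 powr h n) \<le> real (2 ^ 2 ^ (2 * n))"
      using num_XOS_classes_le[of n] unfolding exact[OF that, symmetric] of_nat_le_iff .
    also have "\<dots> = 2 powr (2 powr (2 * real n))"
      by (simp add: powr_realpow flip: of_nat_mult) (simp add: powr_realpow[symmetric])
    finally show ?thesis by simp
  qed
  have lower: "real (n div 2) \<le> h n" if "2 \<le> n" for n
  proof -
    have "(2::nat) ^ 2 ^ (n div 2) \<le> 2 ^ (n choose (n div 2))"
      using two_pow_le_binomial_half by (intro power_increasing) auto
    \<comment> \<open>The middle layer \<open>m = n div 2\<close> is admissible because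
      \<open>n \<ge> 2\<close> gives \<open>m \<ge> 1\<close>.\<close>
    also have "\<dots> \<le> num_XOS_classes n"
      using that by (intro num_XOS_classes_ge) simp
    finally have "real (2 ^ 2 ^ (n div 2)) \<le> 2 powr (2 powr h n)"
      using exact[of n] that by (metis of_nat_le_iff order.trans one_le_numeral)
    moreover have "real (2 ^ 2 ^ (n div 2)) = 2 powr (2 powr real (n div 2))"
      by (simp add: powr_realpow) (simp add: powr_realpow[symmetric])
    ultimately show ?thesis by simp
  qed
  have "h \<in> \<Theta>(\<lambda>n. real n)"
  proof (rule bigthetaI')
    show "eventually (\<lambda>n. 1 / 3 * norm (real n) \<le> norm (h n) \<and>
        norm (h n) \<le> 2 * norm (real n)) sequentially"
      using eventually_ge_at_top[of 2]
    proof eventually_elim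
      case (elim n)
      \<comment> \<open>The constant \<open>1 / 3\<close> absorbs the rounding in
        \<open>n div 2\<close>; equality occurs at \<open>n = 3\<close>.\<close>
      have "n \<le> 3 * (n div 2)"
        using elim by presburger
      then have "real n / 3 \<le> real (n div 2)"
        by linarith
      with lower[OF elim] upper[of n] elim show ?case
        by simp
    qed
  qed simp_all
  with exact show ?thesis by blast
qed

end
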